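(* Let $\mathcal S$ be a finite set and let $(X_n)$ be an irreducible, aperiodic Markov chain on $\mathcal S$ with transition matrix $Q$ and invariant distribution $\pi$. Let $T_1,T_2,\dots$ be i.i.d. positive random variables with common law $\nu$, independent of $(X_n)$. Assume that there are constants $c_1,c_2>0$, $t_0>0$ and $\beta>0$ such that $$\frac{c_1}{t^{\beta}}\le \mathbb P\{T_1>t\}\le \frac{c_2}{t^{\beta}}\qquad\text{for all } t>t_0 .$$ Let $X(t)=X_{N_\nu(t)}$ be the associated semi-Markov process. Then there is a constant $C_1>0$, not depending on $\varepsilon$ (it may depend on $\beta,c_1,c_2,t_0$ and on the embedded chain), such that for every $\varepsilon>0$ $$T^{\mathrm{cont}}_{\varepsilon} < C_1\, \varepsilon^{-1/\beta}\,\bigl(T^{\mathrm{emb}}_{\varepsilon/2}\bigr)^{1+1/\beta},$$ where $T^{\mathrm{cont}}_{\varepsilon}$ is the $\varepsilon$-mixing time of $X(t)$ and $T^{\mathrm{emb}}_{\varepsilon/2}$ is the $\varepsilon/2$-mixing time of the embedded chain $(X_n)$.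
   Context: Counting process: $S_0=0$, $S_n=\sum_{k=1}^n T_k$ for $n\ge 1$, and $N_\nu(t)=\max\{n\ge 0: S_n\le t\}$ for $t\ge 0$. The semi-Markov process is $X(t)=X_{N_\nu(t)}$; $(X_n)$ is called the embedded chain. Transition probabilities: $q^{(n)}_{i,j}=(Q^n)_{i,j}$ are the $n$-step transition probabilities of the embedded chain, and $p_{i,j}(t)=\mathbb P\{X(t)=j\mid X(0)=i\}$, that is, $$p_{i,j}(t)=\mathbb P\{T_1>t\}\,\delta_{ij}+\sum_{n=1}^\infty q^{(n)}_{i,j}\,\mathbb P\{N_\nu(t)=n\}.$$ Total variation distance: $\|\mu-\rho\|=\tfrac12\sum_{x\in\mathcal S}|\mu(x)-\rho(x)|$ for probability measures $\mu,\rho$ on $\mathcal S$. Mixing times (note the sum over starting states $i$): for $\varepsilon>0$, $$T^{\mathrm{emb}}_\varepsilon=\inf\Bigl\{n\in\{1,2,3,\dots\}:\ \sum_{i\in\mathcal S}\|q^{(n)}_{i,\cdot}-\pi\|\le\varepsilon\Bigr\},\qquad T^{\mathrm{cont}}_\varepsilon=\inf\Bigl\{t\ge 0:\ \sum_{i\in\mathcal S}\|p_{i,\cdot}(t)-\pi\|\le\varepsilon\Bigr\}.$$ *)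

theory Defs
  imports "HOL-Probability.Probability"
begin

text \<open>A matrix or a vector indexed by the finite state space \<open>S\<close> is a function on the ambient
  type of which only the values on \<open>S\<close> matter.\<close>

definition stochastic_matrix :: "'s set \<Rightarrow> ('s \<Rightarrow> 's \<Rightarrow> real) \<Rightarrow> bool" where
  "stochastic_matrix S Q \<longleftrightarrow>
     (\<forall>i\<in>S. \<forall>j\<in>S. 0 \<le> Q i j) \<and> (\<forall>i\<in>S. (\<Sum>j\<in>S. Q i j) = 1)"

fun step_prob :: "'s set \<Rightarrow> ('s \<Rightarrow> 's \<Rightarrow> real) \<Rightarrow> nat \<Rightarrow> 's \<Rightarrow> 's \<Rightarrow> real" where
  "step_prob S Q 0 i j = (if i = j then 1 else 0)"
| "step_prob S Q (Suc n) i j = (\<Sum>k\<in>S. step_prob S Q n i k * Q k j)"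

definition irreducible_chain :: "'s set \<Rightarrow> ('s \<Rightarrow> 's \<Rightarrow> real) \<Rightarrow> bool" where
  "irreducible_chain S Q \<longleftrightarrow> (\<forall>i\<in>S. \<forall>j\<in>S. \<exists>n. 0 < step_prob S Q n i j)"

definition aperiodic_chain :: "'s set \<Rightarrow> ('s \<Rightarrow> 's \<Rightarrow> real) \<Rightarrow> bool" where
  "aperiodic_chain S Q \<longleftrightarrow> (\<forall>i\<in>S. Gcd {n. 1 \<le> n \<and> 0 < step_prob S Q n i i} = 1)"

definition invariant_distribution :: "'s set \<Rightarrow> ('s \<Rightarrow> 's \<Rightarrow> real) \<Rightarrow> ('s \<Rightarrow> real) \<Rightarrow> bool" where
  "invariant_distribution S Q \<pi> \<longleftrightarrow>
     (\<forall>i\<in>S. 0 \<le> \<pi> i) \<and> (\<Sum>i\<in>S. \<pi> i) = 1 \<and> (\<forall>j\<in>S. (\<Sum>i\<in>S. \<pi> i * Q i j) = \<pi> j)"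

text \<open>The jump times \<open>S\<^sub>n\<close>; the waiting times are \<open>T 1, T 2, \<dots>\<close>, and \<open>T 0\<close> is never used.\<close>

definition jump_time :: "(nat \<Rightarrow> 'm \<Rightarrow> real) \<Rightarrow> nat \<Rightarrow> 'm \<Rightarrow> real" where
  "jump_time T n \<omega> = (\<Sum>k=1..n. T k \<omega>)"

text \<open>For i.i.d. positive waiting times the set below is almost surely finite; \<open>Max\<close> has no
  meaning on the exceptional null set.\<close>

definition jump_count :: "(nat \<Rightarrow> 'm \<Rightarrow> real) \<Rightarrow> real \<Rightarrow> 'm \<Rightarrow> nat" where
  "jump_count T t \<omega> = Max {n. jump_time T n \<omega> \<le> t}"

definition semi_markov_process ::
    "(nat \<Rightarrow> 'm \<Rightarrow> 's) \<Rightarrow> (nat \<Rightarrow> 'm \<Rightarrow> real) \<Rightarrow> real \<Rightarrow> 'm \<Rightarrow> 's" where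
  "semi_markov_process X T t \<omega> = X (jump_count T t \<omega>) \<omega>"

text \<open>On the probability space \<open>M\<close>, \<open>X\<close> is a Markov chain on \<open>S\<close> with transition matrix \<open>Q\<close>
  (and arbitrary initial law), and the waiting times are i.i.d. with law \<open>\<nu>\<close>, almost surely
  positive and independent of the whole chain. Independence is stated for the generated
  \<open>\<sigma>\<close>-algebras, since \<open>indep_var\<close> needs both variables to have the same type.\<close>

locale semi_markov = prob_space M
  for M :: "'m measure" and S :: "'s set" and Q :: "'s \<Rightarrow> 's \<Rightarrow> real" and \<nu> :: "real measure"
    and X :: "nat \<Rightarrow> 'm \<Rightarrow> 's" and T :: "nat \<Rightarrow> 'm \<Rightarrow> real" +
  assumes X_measurable: "\<And>n. X n \<in> measurable M (count_space S)"
    and X_Markov: "\<And>n x. 0 < \<P>(\<omega> in M. \<forall>k\<le>n. X k \<omega> = x k) \<Longrightarrow> x (Suc n) \<in> S \<Longrightarrow>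
       \<P>(\<omega> in M. X (Suc n) \<omega> = x (Suc n) \<bar> \<forall>k\<le>n. X k \<omega> = x k) = Q (x n) (x (Suc n))"
    and T_indep: "indep_vars (\<lambda>_. borel) T {1..}"
    and T_law: "\<And>k. 1 \<le> k \<Longrightarrow> distr M borel (T k) = \<nu>"
    and T_positive: "\<And>k. 1 \<le> k \<Longrightarrow> AE \<omega> in M. 0 < T k \<omega>"
    and T_X_indep: "indep_set
       (sets (vimage_algebra (space M) (\<lambda>\<omega>. \<lambda>k\<in>{1..}. T k \<omega>) (\<Pi>\<^sub>M k\<in>{1..}. borel)))
       (sets (vimage_algebra (space M) (\<lambda>\<omega> n. X n \<omega>) (\<Pi>\<^sub>M n\<in>UNIV. count_space S)))"

text \<open>Conditioning on \<open>X(0) = i\<close> for every \<open>i\<close> requires an underlying probability that charges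
  \<open>i\<close>. The family \<open>P\<close> supplies one for each \<open>i\<close>: it may be constant (one probability whose
  initial law charges every state), or \<open>P i\<close> may be the law of the process started at \<open>i\<close>.\<close>

definition semi_markov_family ::
    "('s \<Rightarrow> 'm measure) \<Rightarrow> 's set \<Rightarrow> ('s \<Rightarrow> 's \<Rightarrow> real) \<Rightarrow> real measure \<Rightarrow>
     (nat \<Rightarrow> 'm \<Rightarrow> 's) \<Rightarrow> (nat \<Rightarrow> 'm \<Rightarrow> real) \<Rightarrow> bool" where
  "semi_markov_family P S Q \<nu> X T \<longleftrightarrow>
     (\<forall>i\<in>S. semi_markov (P i) S Q \<nu> X T \<and> 0 < \<P>(\<omega> in P i. X 0 \<omega> = i))"

definition trans_prob ::
    "('s \<Rightarrow> 'm measure) \<Rightarrow> (nat \<Rightarrow> 'm \<Rightarrow> 's) \<Rightarrow> (nat \<Rightarrow> 'm \<Rightarrow> real) \<Rightarrow> real \<Rightarrow> 's \<Rightarrow> 's \<Rightarrow> real" where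
  "trans_prob P X T t i j =
     \<P>(\<omega> in P i. semi_markov_process X T t \<omega> = j \<bar> semi_markov_process X T 0 \<omega> = i)"

definition tv_dist :: "'s set \<Rightarrow> ('s \<Rightarrow> real) \<Rightarrow> ('s \<Rightarrow> real) \<Rightarrow> real" where
  "tv_dist S \<mu> \<rho> = 1 / 2 * (\<Sum>x\<in>S. \<bar>\<mu> x - \<rho> x\<bar>)"

definition T_emb :: "'s set \<Rightarrow> ('s \<Rightarrow> 's \<Rightarrow> real) \<Rightarrow> ('s \<Rightarrow> real) \<Rightarrow> real \<Rightarrow> nat" where
  "T_emb S Q \<pi> \<epsilon> = Inf {n. 1 \<le> n \<and> (\<Sum>i\<in>S. tv_dist S (step_prob S Q n i) \<pi>) \<le> \<epsilon>}"

text \<open>Extended reals, so that the infimum of the empty set would be \<open>\<infinity>\<close>.\<close>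

definition T_cont ::
    "'s set \<Rightarrow> ('s \<Rightarrow> 'm measure) \<Rightarrow> (nat \<Rightarrow> 'm \<Rightarrow> 's) \<Rightarrow> (nat \<Rightarrow> 'm \<Rightarrow> real) \<Rightarrow> ('s \<Rightarrow> real) \<Rightarrow>
     real \<Rightarrow> ereal" where
  "T_cont S P X T \<pi> \<epsilon> =
     Inf (ereal ` {t. 0 \<le> t \<and> (\<Sum>i\<in>S. tv_dist S (trans_prob P X T t i) \<pi>) \<le> \<epsilon>})"

end

theory Submission
  imports Defs
begin

text \<open>Write \<open>m\<close> for the \<open>\<epsilon>/2\<close>-mixing time of the embedded chain. Conditionally on the number
  \<open>n\<close> of jumps up to time \<open>t\<close>, the semi-Markov process has the law of the embedded chain after
  \<open>n\<close> steps, so \<open>p\<^sub>i(t)\<close> is the mixture of the rows \<open>q\<^sup>(\<^sup>n\<^sup>)\<^sub>i\<close> with weights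
  \<open>P(N(t) = n)\<close> (lemma \<open>transition_sums\<close>). Total variation distance to \<open>\<pi>\<close> is convex, is at
  most 1, and does not increase along the chain; hence
  \<open>\<parallel>p\<^sub>i(t) - \<pi>\<parallel> \<le> P(N(t) < m) + \<parallel>q\<^sup>(\<^sup>m\<^sup>)\<^sub>i - \<pi>\<parallel>\<close> (lemma
  \<open>tv_dist_semi_markov_le\<close>). Summed over \<open>i\<close>, the last terms contribute at most \<open>\<epsilon>/2\<close>.

  Fewer than \<open>m\<close> jumps up to time \<open>t\<close> means that \<open>m\<close> waiting times add up to more than \<open>t\<close>, so one
  of them exceeds \<open>t/m\<close>. The union bound and the upper tail estimate give
  \<open>P(N(t) < m) \<le> m c\<^sub>2 (m/t)\<^sup>\<beta>\<close> when \<open>t/m > t\<^sub>0\<close> (lemma \<open>prob_few_jumps\<close>). With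
  \<open>t = a \<epsilon>\<^sup>-\<^sup>1\<^sup>/\<^sup>\<beta> m\<^sup>1\<^sup>+\<^sup>1\<^sup>/\<^sup>\<beta>\<close> the powers of \<open>m\<close> and \<open>\<epsilon>\<close> combine so that the sum over
  the states is \<open>|S| c\<^sub>2 a\<^sup>-\<^sup>\<beta> \<epsilon>\<close>, which is at most \<open>\<epsilon>/2\<close> as soon as \<open>a\<^sup>\<beta> \<ge> 2 |S| c\<^sub>2\<close>.
  The requirement \<open>t/m > t\<^sub>0\<close> is a second lower bound on \<open>a\<close> that is uniform for \<open>\<epsilon> < |S|\<close>;
  for larger \<open>\<epsilon>\<close> the process is already mixed at time 0, since each distance is at most 1.

  Two points are needed for the formulas to mean what they should. The mixing time of the embedded
  chain is an infimum of natural numbers and is only informative if the chain mixes at all;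
  this is the convergence theorem for finite irreducible aperiodic chains (lemma
  \<open>embedded_chain_mixes\<close>). And \<open>N(t)\<close> is a maximum, which requires that almost surely only
  finitely many jumps occur by time \<open>t\<close>; this holds because the lower tail estimate makes
  each waiting time exceed \<open>t\<close> with the same positive probability (lemma
  \<open>jump_time_finite_often\<close>).\<close>

section \<open>Numerical semigroups\<close>

lemma additive_closed_mult:
  fixes A :: "nat set"
  assumes "0 \<in> A" "\<And>a b. a \<in> A \<Longrightarrow> b \<in> A \<Longrightarrow> a + b \<in> A" "a \<in> A"
  shows "k * a \<in> A"
  by (induction k) (use assms in auto)

text \<open>The smallest positive difference \<open>d\<close> of two elements divides every element: otherwise the
  remainder of an element modulo \<open>d\<close> would be a smaller difference. So \<open>d\<close> divides the gcd, and
  there are consecutive elements \<open>b\<close> and \<open>b + 1\<close>; their combinations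
  \<open>(q - r) b + r (b + 1) = q b + r\<close> with \<open>r < b \<le> q\<close> reach every number from \<open>b\<^sup>2\<close> on.\<close>

lemma numerical_semigroup_cofinite:
  fixes A :: "nat set"
  assumes zero: "0 \<in> A" and add: "\<And>a b. a \<in> A \<Longrightarrow> b \<in> A \<Longrightarrow> a + b \<in> A"
    and gcd: "Gcd A = 1"
  shows "\<forall>\<^sub>F n in sequentially. n \<in> A"
proof -
  have mult: "k * a \<in> A" if "a \<in> A" for k a
    using additive_closed_mult[of A a k] zero add that by blast
  let ?D = "\<lambda>d. 0 < d \<and> (\<exists>b\<in>A. b + d \<in> A)"
  define d where "d = (LEAST d. ?D d)"
  have "\<not> A \<subseteq> {0}" using gcd by (metis Gcd_0_iff zero_neq_one)
  then obtain a0 where "a0 \<in> A" "a0 > 0" by auto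
  then have "?D a0" using zero by (intro conjI bexI[of _ 0]) auto
  then have "?D d" unfolding d_def by (rule LeastI)
  then obtain b where b: "b \<in> A" "b + d \<in> A" "d > 0" by blast
  have "d dvd a" if "a \<in> A" for a
  proof (rule ccontr)
    assume "\<not> d dvd a"
    then have r: "a mod d > 0" by (simp add: dvd_eq_mod_eq_0)
    have "a div d * (b + d) + a mod d = a + a div d * b"
      by (simp add: add_mult_distrib2 algebra_simps)
    then have "?D (a mod d)"
      using r add[OF that mult[OF b(1)]] mult[OF b(2)] by metis
    then have "d \<le> a mod d" unfolding d_def by (rule Least_le)
    moreover have "a mod d < d" using b(3) by simp
    ultimately show False by simp
  qed
  then have "d dvd Gcd A" by (rule Gcd_greatest)
  then have d1: "d = 1" using gcd by simp
  have "n \<in> A" if n: "n \<ge> b * b" for n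
  proof (cases "b = 0")
    case True
    then have "n * (b + d) \<in> A" using mult[OF b(2)] by blast
    then show ?thesis using True d1 by simp
  next
    case False
    let ?q = "n div b" and ?r = "n mod b"
    have "b \<le> ?q" using n False by (simp add: less_eq_div_iff_mult_less_eq)
    moreover have "?r < b" using False by simp
    ultimately have "?r \<le> ?q" by simp
    then have "(?q - ?r) * b + ?r * (b + d) = ?q * b + ?r"
      using d1 by (simp add: diff_mult_distrib add_mult_distrib2)
    then have "n = (?q - ?r) * b + ?r * (b + d)" by simp
    then show ?thesis using add[OF mult[OF b(1)] mult[OF b(2)]] by metis
  qed
  then show ?thesis using eventually_at_top_linorder by blast
qed

section \<open>Multi-step transition probabilities\<close>

lemma step_prob_nonneg:
  assumes "stochastic_matrix S Q" "i \<in> S" "j \<in> S"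
  shows "0 \<le> step_prob S Q n i j"
  using assms(3)
proof (induction n arbitrary: j)
  case (Suc n)
  then show ?case using assms(1) by (auto simp: stochastic_matrix_def intro!: sum_nonneg)
qed auto

lemma step_prob_sum:
  assumes "finite S" "stochastic_matrix S Q" "i \<in> S"
  shows "(\<Sum>j\<in>S. step_prob S Q n i j) = 1"
proof (induction n)
  case 0
  then show ?case using assms by simp
next
  case (Suc n)
  have "(\<Sum>j\<in>S. step_prob S Q (Suc n) i j) = (\<Sum>k\<in>S. step_prob S Q n i k * (\<Sum>j\<in>S. Q k j))"
    by (simp add: sum_distrib_left) (rule sum.swap)
  then show ?case using Suc assms by (simp add: stochastic_matrix_def)
qed

lemma chapman_kolmogorov:
  assumes "finite S" "j \<in> S"
  shows "step_prob S Q (m + n) i j = (\<Sum>k\<in>S. step_prob S Q m i k * step_prob S Q n k j)"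
  using assms(2)
proof (induction n arbitrary: j)
  case 0
  then show ?case using assms by (simp add: if_distrib cong: if_cong)
next
  case (Suc n)
  have "step_prob S Q (m + Suc n) i j
      = (\<Sum>l\<in>S. \<Sum>k\<in>S. step_prob S Q m i k * (step_prob S Q n k l * Q l j))"
    using Suc.IH by (simp add: sum_distrib_right mult.assoc)
  also have "\<dots> = (\<Sum>k\<in>S. \<Sum>l\<in>S. step_prob S Q m i k * (step_prob S Q n k l * Q l j))"
    by (rule sum.swap)
  finally show ?case by (simp add: sum_distrib_left)
qed

lemma invariant_step_prob:
  assumes "finite S" "invariant_distribution S Q \<pi>" "j \<in> S"
  shows "(\<Sum>i\<in>S. \<pi> i * step_prob S Q n i j) = \<pi> j"
  using assms(3)
proof (induction n arbitrary: j)
  case 0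
  then show ?case using assms by (simp add: if_distrib cong: if_cong)
next
  case (Suc n)
  have "(\<Sum>i\<in>S. \<pi> i * step_prob S Q (Suc n) i j)
      = (\<Sum>i\<in>S. \<Sum>k\<in>S. \<pi> i * step_prob S Q n i k * Q k j)"
    by (simp add: sum_distrib_left mult.assoc)
  also have "\<dots> = (\<Sum>k\<in>S. (\<Sum>i\<in>S. \<pi> i * step_prob S Q n i k) * Q k j)"
    by (subst sum.swap) (simp add: sum_distrib_right)
  also have "\<dots> = \<pi> j"
    using Suc assms(2) by (simp add: invariant_distribution_def)
  finally show ?case .
qed

section \<open>Contraction and convergence of the embedded chain\<close>

lemma tv_dist_le_1:
  assumes "\<And>x. x \<in> S \<Longrightarrow> 0 \<le> \<mu> x" "sum \<mu> S = 1" "\<And>x. x \<in> S \<Longrightarrow> 0 \<le> \<rho> x" "sum \<rho> S = 1"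
  shows "tv_dist S \<mu> \<rho> \<le> 1"
proof -
  have "(\<Sum>x\<in>S. \<bar>\<mu> x - \<rho> x\<bar>) \<le> (\<Sum>x\<in>S. \<mu> x + \<rho> x)"
    using assms(1,3) by (intro sum_mono) (simp add: abs_le_iff add_increasing add_increasing2)
  then show ?thesis using assms(2,4) by (simp add: tv_dist_def sum.distrib)
qed

text \<open>A signed measure of total mass 0 is not changed by the part \<open>\<delta> \<rho>\<close> common to all rows of the
  kernel, so only the remaining part of the kernel, whose rows have mass \<open>1 - \<delta>\<close>, acts on it. The
  case \<open>\<delta> = 0\<close> says that a stochastic kernel does not increase total variation.\<close>

lemma doeblin_contraction:
  fixes K :: "'s \<Rightarrow> 's \<Rightarrow> real"
  assumes minor: "\<And>k j. k \<in> S \<Longrightarrow> j \<in> S \<Longrightarrow> \<delta> * \<rho> j \<le> K k j"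
    and K: "\<And>k. k \<in> S \<Longrightarrow> (\<Sum>j\<in>S. K k j) = 1"
    and rho: "sum \<rho> S = 1" and v: "sum v S = 0"
  shows "(\<Sum>j\<in>S. \<bar>\<Sum>k\<in>S. v k * K k j\<bar>) \<le> (1 - \<delta>) * (\<Sum>k\<in>S. \<bar>v k\<bar>)"
proof -
  have "\<bar>\<Sum>k\<in>S. v k * K k j\<bar> \<le> (\<Sum>k\<in>S. \<bar>v k\<bar> * (K k j - \<delta> * \<rho> j))" if "j \<in> S" for j
  proof -
    have "(\<Sum>k\<in>S. v k * K k j) = (\<Sum>k\<in>S. v k * (K k j - \<delta> * \<rho> j))"
      using v by (simp add: right_diff_distrib sum_subtractf flip: sum_distrib_right)
    also have "\<bar>\<dots>\<bar> \<le> (\<Sum>k\<in>S. \<bar>v k * (K k j - \<delta> * \<rho> j)\<bar>)" by (rule sum_abs)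
    also have "\<dots> = (\<Sum>k\<in>S. \<bar>v k\<bar> * (K k j - \<delta> * \<rho> j))"
      using minor that by (intro sum.cong) (simp_all add: abs_mult)
    finally show ?thesis .
  qed
  then have "(\<Sum>j\<in>S. \<bar>\<Sum>k\<in>S. v k * K k j\<bar>) \<le> (\<Sum>j\<in>S. \<Sum>k\<in>S. \<bar>v k\<bar> * (K k j - \<delta> * \<rho> j))"
    by (rule sum_mono)
  also have "\<dots> = (\<Sum>k\<in>S. \<bar>v k\<bar> * ((\<Sum>j\<in>S. K k j) - \<delta> * sum \<rho> S))"
    by (subst sum.swap) (simp add: sum_subtractf flip: sum_distrib_left)
  also have "\<dots> = (1 - \<delta>) * (\<Sum>k\<in>S. \<bar>v k\<bar>)"
    using K rho by (simp add: sum_distrib_left mult.commute)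
  finally show ?thesis .
qed

text \<open>Since \<open>\<pi>\<close> is invariant, \<open>m\<close> further steps map the difference \<open>q\<^sup>(\<^sup>n\<^sup>)\<^sub>i - \<pi>\<close>, which has
  mass 0, to \<open>q\<^sup>(\<^sup>n\<^sup>+\<^sup>m\<^sup>)\<^sub>i - \<pi>\<close>.\<close>

lemma tv_dist_contraction:
  assumes "finite S" "stochastic_matrix S Q" "invariant_distribution S Q \<pi>" "i \<in> S"
    and minor: "\<And>k j. k \<in> S \<Longrightarrow> j \<in> S \<Longrightarrow> \<delta> * \<pi> j \<le> step_prob S Q m k j"
  shows "tv_dist S (step_prob S Q (n + m) i) \<pi> \<le> (1 - \<delta>) * tv_dist S (step_prob S Q n i) \<pi>"
proof -
  let ?v = "\<lambda>k. step_prob S Q n i k - \<pi> k"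
  have pi: "sum \<pi> S = 1" using assms(3) by (simp add: invariant_distribution_def)
  have "step_prob S Q (n + m) i j - \<pi> j = (\<Sum>k\<in>S. ?v k * step_prob S Q m k j)" if "j \<in> S" for j
    using that assms by (simp add: chapman_kolmogorov left_diff_distrib sum_subtractf invariant_step_prob)
  moreover have "(\<Sum>j\<in>S. \<bar>\<Sum>k\<in>S. ?v k * step_prob S Q m k j\<bar>) \<le> (1 - \<delta>) * (\<Sum>k\<in>S. \<bar>?v k\<bar>)"
    using assms pi by (intro doeblin_contraction[of S \<delta> \<pi>]) (auto simp: step_prob_sum sum_subtractf)
  ultimately show ?thesis by (simp add: tv_dist_def)
qed

lemma tv_dist_step_prob_antimono:
  assumes "finite S" "stochastic_matrix S Q" "invariant_distribution S Q \<pi>" "i \<in> S" "m \<le> n"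
  shows "tv_dist S (step_prob S Q n i) \<pi> \<le> tv_dist S (step_prob S Q m i) \<pi>"
  using tv_dist_contraction[OF assms(1-4), of 0 "n - m" m] assms
  by (simp add: step_prob_nonneg)

text \<open>The possible return times to a state form a numerical semigroup with gcd 1, so all late
  times are return times; one path from \<open>i\<close> to \<open>j\<close> appended to them makes all late times possible
  for the passage from \<open>i\<close> to \<open>j\<close>.\<close>

lemma step_prob_eventually_positive:
  assumes S: "finite S" and Q: "stochastic_matrix S Q"
    and irr: "irreducible_chain S Q" and aper: "aperiodic_chain S Q"
  shows "\<forall>\<^sub>F n in sequentially. \<forall>i\<in>S. \<forall>j\<in>S. 0 < step_prob S Q n i j"
proof -
  have path: "0 < step_prob S Q (m + n) i j"
    if "i \<in> S" "k \<in> S" "j \<in> S" "0 < step_prob S Q m i k" "0 < step_prob S Q n k j" for i j k m n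
  proof -
    have "0 < step_prob S Q m i k * step_prob S Q n k j" using that by simp
    also have "\<dots> \<le> (\<Sum>k\<in>S. step_prob S Q m i k * step_prob S Q n k j)"
      using that S Q by (intro member_le_sum) (auto simp: step_prob_nonneg)
    finally show ?thesis using S that by (simp add: chapman_kolmogorov)
  qed
  have "\<forall>\<^sub>F n in sequentially. 0 < step_prob S Q n i j" if ij: "i \<in> S" "j \<in> S" for i j
  proof -
    let ?A = "{n. 0 < step_prob S Q n i i}"
    \<comment> \<open>Time 0 always counts as a return and does not change the gcd.\<close>
    have "?A = insert 0 {n. 1 \<le> n \<and> 0 < step_prob S Q n i i}"
      by (auto simp: not_less_eq_eq)
    then have "Gcd ?A = 1" using aper ij by (simp add: aperiodic_chain_def)
    then have "\<forall>\<^sub>F n in sequentially. n \<in> ?A"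
      using path ij by (intro numerical_semigroup_cofinite) auto
    then obtain N where N: "\<And>n. n \<ge> N \<Longrightarrow> 0 < step_prob S Q n i i"
      by (auto simp: eventually_at_top_linorder)
    obtain r where r: "0 < step_prob S Q r i j" using irr ij by (auto simp: irreducible_chain_def)
    have "0 < step_prob S Q n i j" if "n \<ge> N + r" for n
      using path[OF ij(1) ij N[of "n - r"] r] that by simp
    then show ?thesis by (auto simp: eventually_at_top_linorder)
  qed
  then show ?thesis using S by (auto intro!: eventually_ball_finite)
qed

text \<open>Some power \<open>Q\<^sup>m\<close> has only positive entries. Its smallest entry \<open>\<delta>\<close> serves in a Doeblin
  condition with reference measure \<open>\<pi>\<close>, because \<open>\<pi> \<le> 1\<close>; the distance to \<open>\<pi>\<close> is then
  multiplied by at most \<open>1 - \<delta>\<close> in every \<open>m\<close> steps.\<close>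

lemma embedded_chain_mixes:
  assumes S: "finite S" and Q: "stochastic_matrix S Q"
    and irr: "irreducible_chain S Q" and aper: "aperiodic_chain S Q"
    and inv: "invariant_distribution S Q \<pi>" and "\<epsilon> > 0"
  shows "\<exists>n\<ge>1. (\<Sum>i\<in>S. tv_dist S (step_prob S Q n i) \<pi>) \<le> \<epsilon>"
proof -
  have pi: "\<And>j. j \<in> S \<Longrightarrow> 0 \<le> \<pi> j" "sum \<pi> S = 1"
    using inv by (auto simp: invariant_distribution_def)
  have "S \<noteq> {}" using pi(2) by auto
  obtain m where m: "m \<ge> 1" "\<And>i j. i \<in> S \<Longrightarrow> j \<in> S \<Longrightarrow> 0 < step_prob S Q m i j"
    using step_prob_eventually_positive[OF S Q irr aper]
    by (auto simp: eventually_at_top_linorder) (meson nle_le)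
  define E where "E = (\<lambda>(i,j). step_prob S Q m i j) ` (S \<times> S)"
  define \<delta> where "\<delta> = Min E"
  have E: "finite E" "E \<noteq> {}" using S \<open>S \<noteq> {}\<close> by (auto simp: E_def)
  have "\<delta> > 0" using m(2) E by (auto simp: \<delta>_def E_def)
  have lower: "\<delta> \<le> step_prob S Q m i j" if "i \<in> S" "j \<in> S" for i j
    unfolding \<delta>_def using E that by (intro Min_le) (auto simp: E_def)
  have minor: "\<delta> * \<pi> j \<le> step_prob S Q m i j" if "i \<in> S" "j \<in> S" for i j
  proof -
    have "\<pi> j \<le> 1" using member_le_sum[of j S \<pi>] pi S that by auto
    then have "\<delta> * \<pi> j \<le> \<delta>" using \<open>\<delta> > 0\<close> by (simp add: mult_left_le)
    then show ?thesis using lower[OF that] by linarith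
  qed
  have "\<delta> \<le> 1"
  proof -
    obtain i where "i \<in> S" using \<open>S \<noteq> {}\<close> by blast
    have "\<delta> \<le> step_prob S Q m i i" by (rule lower) fact+
    also have "\<dots> \<le> (\<Sum>j\<in>S. step_prob S Q m i j)"
      using S Q \<open>i \<in> S\<close> by (intro member_le_sum) (auto simp: step_prob_nonneg)
    also have "\<dots> = 1" using S Q \<open>i \<in> S\<close> by (rule step_prob_sum)
    finally show ?thesis .
  qed
  have geometric: "tv_dist S (step_prob S Q (r * m) i) \<pi> \<le> (1 - \<delta>) ^ r" if "i \<in> S" for i r
  proof (induction r)
    case 0
    show ?case
      using pi that S Q step_prob_sum[OF S Q that, of 0] step_prob_nonneg[OF Q that, of _ 0]
      by (auto intro!: tv_dist_le_1)
  next
    case (Suc r)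
    have "tv_dist S (step_prob S Q (Suc r * m) i) \<pi> \<le> (1 - \<delta>) * tv_dist S (step_prob S Q (r * m) i) \<pi>"
      using tv_dist_contraction[OF S Q inv that minor, of "r * m"] by (simp add: add.commute)
    also have "\<dots> \<le> (1 - \<delta>) * (1 - \<delta>) ^ r" using Suc \<open>\<delta> \<le> 1\<close> by (intro mult_left_mono) auto
    finally show ?case by simp
  qed
  have "(\<lambda>r. card S * (1 - \<delta>) ^ r) \<longlonglongrightarrow> real (card S) * 0"
    using \<open>0 < \<delta>\<close> \<open>\<delta> \<le> 1\<close> by (intro tendsto_mult_left LIMSEQ_realpow_zero) auto
  then have "\<forall>\<^sub>F r in sequentially. card S * (1 - \<delta>) ^ r < \<epsilon>"
    using \<open>\<epsilon> > 0\<close> by (intro order_tendstoD(2)[where a=\<epsilon>]) auto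
  then have "\<forall>\<^sub>F r in sequentially. card S * (1 - \<delta>) ^ r < \<epsilon> \<and> 1 \<le> r"
    by (intro eventually_conj eventually_ge_at_top)
  then obtain r where r: "card S * (1 - \<delta>) ^ r < \<epsilon>" "1 \<le> r"
    using eventually_happens trivial_limit_sequentially by blast
  have "(\<Sum>i\<in>S. tv_dist S (step_prob S Q (r * m) i) \<pi>) \<le> card S * (1 - \<delta>) ^ r"
    using geometric by (intro sum_bounded_above) auto
  moreover have "1 \<le> r * m" using r(2) m(1) by simp
  ultimately show ?thesis using r(1) by (meson less_imp_le order_trans)
qed

text \<open>The infimum of an empty set of natural numbers is 0, so both claims rest on the chain mixing.\<close>

lemma T_emb_attained:
  assumes "finite S" "stochastic_matrix S Q" "irreducible_chain S Q" "aperiodic_chain S Q"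
    "invariant_distribution S Q \<pi>" "\<epsilon> > 0"
  shows "1 \<le> T_emb S Q \<pi> \<epsilon>"
    and "(\<Sum>i\<in>S. tv_dist S (step_prob S Q (T_emb S Q \<pi> \<epsilon>) i) \<pi>) \<le> \<epsilon>"
proof -
  let ?N = "{n. 1 \<le> n \<and> (\<Sum>i\<in>S. tv_dist S (step_prob S Q n i) \<pi>) \<le> \<epsilon>}"
  have "?N \<noteq> {}" using embedded_chain_mixes[OF assms] by auto
  then have "T_emb S Q \<pi> \<epsilon> \<in> ?N" unfolding T_emb_def by (rule Inf_nat_def1)
  then show "1 \<le> T_emb S Q \<pi> \<epsilon>"
    and "(\<Sum>i\<in>S. tv_dist S (step_prob S Q (T_emb S Q \<pi> \<epsilon>) i) \<pi>) \<le> \<epsilon>" by auto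
qed

section \<open>Total variation distance of a mixture\<close>

text \<open>By convexity the distance of a countable mixture is at most the mixture of the distances; the
  first \<open>m\<close> components are estimated by 1 and the others by \<open>d\<close>. The estimate is made for the partial
  sums and then passed to the limit.\<close>

lemma tv_dist_mixture:
  assumes a: "\<And>n. 0 \<le> a n" "a sums 1"
    and p: "\<And>j. j \<in> S \<Longrightarrow> (\<lambda>n. a n * q n j) sums p j"
    and early: "\<And>n. n < m \<Longrightarrow> tv_dist S (q n) \<rho> \<le> 1"
    and late: "\<And>n. m \<le> n \<Longrightarrow> tv_dist S (q n) \<rho> \<le> d" and "0 \<le> d"
  shows "tv_dist S p \<rho> \<le> (\<Sum>n<m. a n) + d"
proof -
  have diff: "(\<lambda>n. a n * (q n j - \<rho> j)) sums (p j - \<rho> j)" if "j \<in> S" for j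
    using sums_diff[OF p[OF that] sums_mult2[OF a(2), of "\<rho> j"]] by (simp add: right_diff_distrib)
  have bound: "a n * tv_dist S (q n) \<rho> \<le> (if n < m then a n else 0) + a n * d" for n
    using mult_left_mono[OF early[of n] a(1)[of n]] mult_left_mono[OF late[of n] a(1)[of n]]
      a(1)[of n] \<open>0 \<le> d\<close> by (cases "n < m") (auto intro: order_trans)
  have dom: "(\<lambda>n. (if n < m then a n else 0) + a n * d) sums ((\<Sum>n<m. a n) + 1 * d)"
    using sums_If_finite[of "\<lambda>n. n < m" a] by (intro sums_add sums_mult2 a) (simp add: lessThan_def)
  have part: "(\<Sum>j\<in>S. \<bar>\<Sum>n<r. a n * (q n j - \<rho> j)\<bar>) / 2 \<le> (\<Sum>n<m. a n) + d" for r
  proof -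
    have "(\<Sum>j\<in>S. \<bar>\<Sum>n<r. a n * (q n j - \<rho> j)\<bar>) \<le> (\<Sum>j\<in>S. \<Sum>n<r. a n * \<bar>q n j - \<rho> j\<bar>)"
      using a(1) by (intro sum_mono order_trans[OF sum_abs]) (simp add: abs_mult)
    also have "\<dots> = (\<Sum>n<r. 2 * (a n * tv_dist S (q n) \<rho>))"
      by (subst sum.swap) (simp add: tv_dist_def flip: sum_distrib_left)
    also have "\<dots> \<le> (\<Sum>n<r. 2 * ((if n < m then a n else 0) + a n * d))"
      by (intro sum_mono mult_left_mono bound) simp
    also have "\<dots> = 2 * (\<Sum>n<r. (if n < m then a n else 0) + a n * d)"
      by (simp add: sum_distrib_left)
    also have "\<dots> \<le> 2 * ((\<Sum>n<m. a n) + 1 * d)"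
      using a(1) \<open>0 \<le> d\<close> sums_unique[OF dom] sums_summable[OF dom]
      by (intro mult_left_mono) (auto simp del: mult_1 intro!: sum_le_suminf)
    finally show ?thesis by simp
  qed
  have lim: "(\<lambda>r. (\<Sum>j\<in>S. \<bar>\<Sum>n<r. a n * (q n j - \<rho> j)\<bar>) / 2) \<longlonglongrightarrow> (\<Sum>j\<in>S. \<bar>p j - \<rho> j\<bar>) / 2"
    using diff unfolding sums_def by (intro tendsto_intros) auto
  have "(\<Sum>j\<in>S. \<bar>p j - \<rho> j\<bar>) / 2 \<le> (\<Sum>n<m. a n) + d"
    using part by (intro LIMSEQ_le_const2[OF lim]) blast
  then show ?thesis by (simp add: tv_dist_def)
qed

section \<open>The semi-Markov process\<close>

context semi_markov begin

lemma random_variable_T [measurable]: "1 \<le> k \<Longrightarrow> T k \<in> borel_measurable M"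
  using T_indep by (auto simp: indep_vars_def)

lemma random_variable_jump_count [measurable]: "jump_count T t \<in> measurable M (count_space UNIV)"
  unfolding jump_count_def jump_time_def by measurable

lemma event_X_eq [measurable]: "{\<omega>\<in>space M. X n \<omega> = i} \<in> events"
proof -
  have "{\<omega>\<in>space M. X n \<omega> = i} = X n -` ({i} \<inter> S) \<inter> space M"
    using measurable_space[OF X_measurable] by auto
  also have "\<dots> \<in> events" by (rule measurable_sets[OF X_measurable]) auto
  finally show ?thesis .
qed

lemma event_jump_count_eq [measurable]: "{\<omega>\<in>space M. jump_count T t \<omega> = n} \<in> events"
  by measurable

text \<open>The Markov property is given for complete histories. This splitting along the histories with
  given first and last state transfers it to pairs of times; the event \<open>A\<close> is later the next step.\<close>

lemma prob_path_decomposition: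
  assumes S: "finite S" and A: "{\<omega>\<in>space M. A \<omega>} \<in> events"
  shows "prob {\<omega>\<in>space M. X 0 \<omega> = i \<and> X n \<omega> = k \<and> A \<omega>}
    = (\<Sum>x | x \<in> {..n} \<rightarrow>\<^sub>E S \<and> x 0 = i \<and> x n = k.
         prob {\<omega>\<in>space M. (\<forall>l\<le>n. X l \<omega> = x l) \<and> A \<omega>})"
proof -
  let ?B = "{x. x \<in> {..n} \<rightarrow>\<^sub>E S \<and> x 0 = i \<and> x n = k}"
  let ?E = "\<lambda>x. {\<omega>\<in>space M. (\<forall>l\<le>n. X l \<omega> = x l) \<and> A \<omega>}"
  have "finite ({..n} \<rightarrow>\<^sub>E S)" using S by (intro finite_PiE) auto
  then have fin: "finite ?B" by (rule rev_finite_subset) auto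
  have "{\<omega>\<in>space M. X 0 \<omega> = i \<and> X n \<omega> = k \<and> A \<omega>} = (\<Union>x\<in>?B. ?E x)"
  proof (intro equalityI subsetI)
    fix \<omega> assume \<omega>: "\<omega> \<in> {\<omega>\<in>space M. X 0 \<omega> = i \<and> X n \<omega> = k \<and> A \<omega>}"
    let ?x = "restrict (\<lambda>l. X l \<omega>) {..n}"
    have "?x \<in> ?B" "\<omega> \<in> ?E ?x" using \<omega> measurable_space[OF X_measurable] by auto
    then show "\<omega> \<in> (\<Union>x\<in>?B. ?E x)" by blast
  qed auto
  moreover have "?E ` ?B \<subseteq> events"
  proof (rule image_subsetI)
    fix x
    have "{\<omega>\<in>space M. \<forall>l\<in>{..n}. X l \<omega> = x l} \<in> events"
      by (intro sets.sets_Collect_finite_All event_X_eq) auto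
    then have "{\<omega>\<in>space M. \<forall>l\<le>n. X l \<omega> = x l} \<in> events" by (simp add: Ball_def)
    then show "?E x \<in> events" using A by (intro sets.sets_Collect_conj)
  qed
  moreover have "disjoint_family_on ?E ?B"
    unfolding disjoint_family_on_def
  proof (intro ballI impI)
    fix x y assume xy: "x \<in> ?B" "y \<in> ?B" "x \<noteq> y"
    have "\<exists>l\<in>{..n}. x l \<noteq> y l"
    proof (rule ccontr)
      assume "\<not> ?thesis"
      then have "x = y" using xy by (intro PiE_ext[of x "{..n}" "\<lambda>_. S" y]) auto
      then show False using xy(3) by simp
    qed
    then obtain l where "l \<le> n" "x l \<noteq> y l" by auto
    then show "?E x \<inter> ?E y = {}" by auto
  qed
  ultimately show ?thesis
    using finite_measure_finite_Union[OF fin, of ?E] by (simp only:)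
qed

lemma prob_one_more_step:
  assumes S: "finite S" and "j \<in> S"
  shows "prob {\<omega>\<in>space M. X 0 \<omega> = i \<and> X n \<omega> = k \<and> X (Suc n) \<omega> = j}
    = prob {\<omega>\<in>space M. X 0 \<omega> = i \<and> X n \<omega> = k} * Q k j"
proof -
  have path: "prob {\<omega>\<in>space M. (\<forall>l\<le>n. X l \<omega> = x l) \<and> X (Suc n) \<omega> = j}
      = prob {\<omega>\<in>space M. \<forall>l\<le>n. X l \<omega> = x l} * Q (x n) j" for x
  \<comment> \<open>The Markov property conditions on the history, so histories of probability 0 are separate.\<close>
  proof (cases "prob {\<omega>\<in>space M. \<forall>l\<le>n. X l \<omega> = x l} = 0")
    case True
    have "{\<omega>\<in>space M. \<forall>l\<in>{..n}. X l \<omega> = x l} \<in> events"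
      by (intro sets.sets_Collect_finite_All event_X_eq) auto
    then have "prob {\<omega>\<in>space M. (\<forall>l\<le>n. X l \<omega> = x l) \<and> X (Suc n) \<omega> = j}
      \<le> prob {\<omega>\<in>space M. \<forall>l\<le>n. X l \<omega> = x l}"
      by (intro finite_measure_mono) (auto simp: Ball_def)
    then show ?thesis using True by (simp add: measure_le_0_iff)
  next
    case False
    let ?x = "x(Suc n := j)"
    have eq: "(\<forall>l\<le>n. X l \<omega> = ?x l) \<longleftrightarrow> (\<forall>l\<le>n. X l \<omega> = x l)" for \<omega> by auto
    have "\<P>(\<omega> in M. X (Suc n) \<omega> = j \<bar> \<forall>l\<le>n. X l \<omega> = x l) = Q (x n) j"
      using X_Markov[of n ?x, unfolded eq] False \<open>j \<in> S\<close> by (simp add: zero_less_measure_iff)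
    then show ?thesis
      using False unfolding cond_prob_def by (simp add: field_simps conj_commute)
  qed
  have "prob {\<omega>\<in>space M. X 0 \<omega> = i \<and> X n \<omega> = k \<and> X (Suc n) \<omega> = j}
    = (\<Sum>x | x \<in> {..n} \<rightarrow>\<^sub>E S \<and> x 0 = i \<and> x n = k.
         prob {\<omega>\<in>space M. \<forall>l\<le>n. X l \<omega> = x l} * Q (x n) j)"
    unfolding path[symmetric] by (intro prob_path_decomposition S event_X_eq)
  also have "\<dots> = (\<Sum>x | x \<in> {..n} \<rightarrow>\<^sub>E S \<and> x 0 = i \<and> x n = k.
         prob {\<omega>\<in>space M. \<forall>l\<le>n. X l \<omega> = x l}) * Q k j"
    by (simp add: sum_distrib_right)
  also have "\<dots> = prob {\<omega>\<in>space M. X 0 \<omega> = i \<and> X n \<omega> = k} * Q k j"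
    using prob_path_decomposition[OF S, of "\<lambda>_. True" i n k] by simp
  finally show ?thesis .
qed

lemma prob_chain:
  assumes S: "finite S" and "j \<in> S"
  shows "prob {\<omega>\<in>space M. X 0 \<omega> = i \<and> X n \<omega> = j}
    = prob {\<omega>\<in>space M. X 0 \<omega> = i} * step_prob S Q n i j"
  using assms(2)
proof (induction n arbitrary: j)
  case 0
  have "{\<omega>\<in>space M. X 0 \<omega> = i \<and> X 0 \<omega> = j}
      = (if i = j then {\<omega>\<in>space M. X 0 \<omega> = i} else {})" by auto
  then show ?case by simp
next
  case (Suc n)
  let ?E = "\<lambda>k. {\<omega>\<in>space M. X 0 \<omega> = i \<and> X n \<omega> = k \<and> X (Suc n) \<omega> = j}"
  have "{\<omega>\<in>space M. X 0 \<omega> = i \<and> X (Suc n) \<omega> = j} = (\<Union>k\<in>S. ?E k)"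
    using measurable_space[OF X_measurable] by auto
  moreover have "?E ` S \<subseteq> events" by (auto intro!: sets.sets_Collect_conj event_X_eq)
  ultimately have "prob {\<omega>\<in>space M. X 0 \<omega> = i \<and> X (Suc n) \<omega> = j} = (\<Sum>k\<in>S. prob (?E k))"
    using finite_measure_finite_Union[OF S, of ?E] by (simp only:) (auto simp: disjoint_family_on_def)
  also have "\<dots> = (\<Sum>k\<in>S. prob {\<omega>\<in>space M. X 0 \<omega> = i} * step_prob S Q n i k * Q k j)"
    using Suc S by (simp add: prob_one_more_step)
  finally show ?case by (simp add: sum_distrib_left mult.assoc)
qed

text \<open>The number of jumps is a measurable function of the waiting times, hence measurable for the
  \<open>\<sigma>\<close>-algebra that they generate, which is independent of that of the chain.\<close>

lemma jump_count_indep_chain: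
  "prob {\<omega>\<in>space M. X 0 \<omega> = i \<and> X n \<omega> = j \<and> jump_count T t \<omega> = m}
    = prob {\<omega>\<in>space M. jump_count T t \<omega> = m} * prob {\<omega>\<in>space M. X 0 \<omega> = i \<and> X n \<omega> = j}"
proof -
  let ?FT = "vimage_algebra (space M) (\<lambda>\<omega>. \<lambda>k\<in>{1..}. T k \<omega>) (\<Pi>\<^sub>M k\<in>{1..}. borel) :: 'm measure"
  let ?FX = "vimage_algebra (space M) (\<lambda>\<omega> n. X n \<omega>) (\<Pi>\<^sub>M n\<in>UNIV. count_space S)"
  have T_FT [measurable]: "T k \<in> borel_measurable ?FT" if "1 \<le> k" for k
  proof -
    have "(\<lambda>\<omega>. \<lambda>k\<in>{1..}. T k \<omega>) \<in> measurable ?FT (\<Pi>\<^sub>M k\<in>{1..}. borel)"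
      by (rule measurable_vimage_algebra1) (auto simp: space_PiM)
    from measurable_compose[OF this measurable_component_singleton[of k]] that
    show ?thesis by simp
  qed
  have "jump_count T t \<in> measurable ?FT (count_space UNIV)"
    unfolding jump_count_def jump_time_def by measurable
  from measurable_sets[OF this, of "{m}"]
  have N: "{\<omega>\<in>space M. jump_count T t \<omega> = m} \<in> sets ?FT"
    by (simp add: vimage_def Int_def conj_commute)
  have X_FX: "X n \<in> measurable ?FX (count_space S)" for n
  proof -
    have "(\<lambda>\<omega> n. X n \<omega>) \<in> measurable ?FX (\<Pi>\<^sub>M n\<in>UNIV. count_space S)"
      using measurable_space[OF X_measurable] by (intro measurable_vimage_algebra1) (auto simp: space_PiM)
    from measurable_compose[OF this measurable_component_singleton[of n]]
    show ?thesis by simp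
  qed
  have X_eq: "{\<omega>\<in>space M. X n \<omega> = i} \<in> sets ?FX" for n i
  proof -
    have "{\<omega>\<in>space M. X n \<omega> = i} = X n -` ({i} \<inter> S) \<inter> space ?FX"
      using measurable_space[OF X_measurable] by auto
    also have "\<dots> \<in> sets ?FX" by (rule measurable_sets[OF X_FX]) auto
    finally show ?thesis .
  qed
  have "{\<omega>\<in>space M. X 0 \<omega> = i \<and> X n \<omega> = j} \<in> sets ?FX"
    using sets.Int[OF X_eq[of 0 i] X_eq[of n j]] by (simp add: Int_def conj_ac)
  from indep_setD[OF T_X_indep N this] show ?thesis
    by (auto simp: Int_def conj_ac intro!: arg_cong[where f=prob])
qed

lemma prob_T_greater:
  assumes "1 \<le> k"
  shows "prob {\<omega>\<in>space M. T k \<omega> > t} = measure \<nu> {t<..}"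
  using assms by (subst T_law[symmetric]) (auto simp: measure_distr vimage_def Int_def conj_commute)

text \<open>If infinitely many jumps occur by time \<open>t\<close>, then no waiting time exceeds \<open>t\<close>, since the jump
  times increase. By independence, the first \<open>n\<close> waiting times stay below \<open>t\<close> with a probability
  that decays geometrically in \<open>n\<close>.\<close>

lemma jump_time_finite_often:
  assumes pos: "measure \<nu> {t<..} > 0"
  shows "AE \<omega> in M. finite {n. jump_time T n \<omega> \<le> t}"
proof -
  let ?p = "1 - measure \<nu> {t<..}"
  define B where "B n = {\<omega>\<in>space M. \<forall>k\<in>{1..n}. T k \<omega> \<le> t}" for n
  have B_event: "B n \<in> events" for n
    unfolding B_def by (intro sets.sets_Collect_finite_All) auto
  have single: "prob {\<omega>\<in>space M. T k \<omega> \<le> t} = ?p" if "1 \<le> k" for k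
  proof -
    have "{\<omega>\<in>space M. T k \<omega> \<le> t} = space M - {\<omega>\<in>space M. T k \<omega> > t}" by auto
    then show ?thesis using that by (simp add: prob_compl prob_T_greater)
  qed
  have B_prob: "prob (B n) = ?p ^ n" for n
  proof (cases "n = 0")
    case True
    then show ?thesis by (simp add: B_def prob_space)
  next
    case False
    then have "B n = (\<Inter>k\<in>{1..n}. T k -` {..t} \<inter> space M)" by (auto simp: B_def)
    also have "prob \<dots> = (\<Prod>k\<in>{1..n}. prob (T k -` {..t} \<inter> space M))"
      using False by (intro indep_varsD[OF T_indep]) auto
    also have "\<dots> = (\<Prod>k\<in>{1..n}. ?p)"
      using single by (intro prod.cong) (auto simp: vimage_def Int_def conj_commute)
    finally show ?thesis by simp
  qed
  have "?p \<ge> 0" using B_prob[of 1] measure_nonneg[of M "B 1"] by simp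
  then have "(\<lambda>n. prob (B n)) \<longlonglongrightarrow> 0"
    unfolding B_prob using pos by (intro LIMSEQ_realpow_zero) auto
  moreover have "prob (\<Inter>n. B n) \<le> prob (B n)" for n
    by (intro finite_measure_mono B_event) auto
  ultimately have "prob (\<Inter>n. B n) \<le> 0"
    by (intro LIMSEQ_le_const) auto
  moreover have "(\<Inter>n. B n) \<in> events" using B_event by auto
  ultimately have null: "(\<Inter>n. B n) \<in> null_sets M"
    by (simp add: null_sets_def emeasure_eq_measure measure_le_0_iff)
  have "AE \<omega> in M. \<forall>k\<in>{1..}. 0 < T k \<omega>"
    using T_positive by (intro AE_ball_countable[THEN iffD2]) auto
  with AE_not_in[OF null] AE_space show ?thesis
  proof eventually_elim
    case (elim \<omega>)
    then obtain k n where k: "1 \<le> k" "k \<le> n" "T k \<omega> > t" by (auto simp: B_def not_le)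
    have "jump_time T m \<omega> > t" if "m \<ge> k" for m
    proof -
      have "T k \<omega> \<le> jump_time T m \<omega>"
        unfolding jump_time_def using elim k that by (intro member_le_sum) (auto simp: less_imp_le)
      then show ?thesis using k by simp
    qed
    then have "{n. jump_time T n \<omega> \<le> t} \<subseteq> {..<k}" by (auto simp: not_less[symmetric])
    then show ?case by (rule finite_subset) simp
  qed
qed

text \<open>If fewer than \<open>m\<close> jumps occur by time \<open>t\<close>, then the first \<open>m\<close> waiting times add up to more than
  \<open>t\<close>, so one of them exceeds the average \<open>t / m\<close>. The inference from the value of \<open>Max\<close> to the
  jump time needs the set of jumps by time \<open>t\<close> to be finite, hence the assumption on \<open>\<nu>\<close>.\<close>

lemma prob_few_jumps:
  assumes m: "1 \<le> m" and pos: "measure \<nu> {t<..} > 0"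
  shows "prob {\<omega>\<in>space M. jump_count T t \<omega> < m} \<le> m * measure \<nu> {t / m<..}"
proof -
  let ?E = "\<lambda>k. {\<omega>\<in>space M. T k \<omega> > t / m}"
  have ev: "?E k \<in> events" if "k \<in> {1..m}" for k using that by auto
  have "AE \<omega> in M. \<omega> \<in> {\<omega>\<in>space M. jump_count T t \<omega> < m} \<longrightarrow> \<omega> \<in> (\<Union>k\<in>{1..m}. ?E k)"
    using jump_time_finite_often[OF pos] AE_space
  proof eventually_elim
    case (elim \<omega>)
    show ?case
    proof (intro impI, rule ccontr)
      assume few: "\<omega> \<in> {\<omega>\<in>space M. jump_count T t \<omega> < m}" and "\<omega> \<notin> (\<Union>k\<in>{1..m}. ?E k)"
      then have "T k \<omega> \<le> t / m" if "k \<in> {1..m}" for k using that elim by (auto simp: not_less)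
      then have "jump_time T m \<omega> \<le> (\<Sum>k=1..m. t / m)" unfolding jump_time_def by (rule sum_mono)
      also have "\<dots> = t" using m by simp
      finally have "m \<le> jump_count T t \<omega>" unfolding jump_count_def using elim by (intro Max_ge) auto
      then show False using few by simp
    qed
  qed
  then have "prob {\<omega>\<in>space M. jump_count T t \<omega> < m} \<le> prob (\<Union>k\<in>{1..m}. ?E k)"
    using ev by (intro finite_measure_mono_AE) auto
  also have "\<dots> \<le> (\<Sum>k\<in>{1..m}. prob (?E k))"
    using ev by (intro finite_measure_subadditive_finite) auto
  also have "\<dots> = m * measure \<nu> {t / m<..}" by (simp add: prob_T_greater)
  finally show ?thesis .
qed

text \<open>Waiting times are positive almost surely, so no jump has happened at time 0 and conditioning on
  the initial state of the process is conditioning on that of the chain.\<close>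

lemma semi_markov_process_0: "AE \<omega> in M. semi_markov_process X T 0 \<omega> = X 0 \<omega>"
proof -
  have "AE \<omega> in M. \<forall>k\<in>{1..}. 0 < T k \<omega>"
    using T_positive by (intro AE_ball_countable[THEN iffD2]) auto
  then show ?thesis
  proof eventually_elim
    case (elim \<omega>)
    have "jump_time T n \<omega> > 0" if "n > 0" for n
      unfolding jump_time_def using elim that by (intro sum_pos) auto
    moreover have "jump_time T 0 \<omega> = 0" by (simp add: jump_time_def)
    ultimately have "jump_time T n \<omega> \<le> 0 \<longleftrightarrow> n = 0" for n by (metis gr_zeroI leD order_refl)
    then have "{n. jump_time T n \<omega> \<le> 0} = {0}" by simp
    then show ?case by (simp add: semi_markov_process_def jump_count_def)
  qed
qed

lemma event_semi_markov_process [measurable]: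
  "{\<omega>\<in>space M. semi_markov_process X T t \<omega> = j} \<in> events"
proof -
  have "{\<omega>\<in>space M. semi_markov_process X T t \<omega> = j}
     = (\<Union>n. {\<omega>\<in>space M. jump_count T t \<omega> = n \<and> X n \<omega> = j})"
    by (auto simp: semi_markov_process_def)
  also have "\<dots> \<in> events"
    by (intro sets.countable_UN' sets.sets_Collect_conj event_jump_count_eq event_X_eq) auto
  finally show ?thesis .
qed

text \<open>The law of total probability over the number of jumps. Independence of
  the waiting times and the chain factorises each term, and the probability of the initial state
  cancels.\<close>

lemma transition_sums:
  assumes S: "finite S" and j: "j \<in> S" and i: "0 < prob {\<omega>\<in>space M. X 0 \<omega> = i}"
  shows "(\<lambda>n. prob {\<omega>\<in>space M. jump_count T t \<omega> = n} * step_prob S Q n i j) sums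
    \<P>(\<omega> in M. semi_markov_process X T t \<omega> = j \<bar> semi_markov_process X T 0 \<omega> = i)"
proof -
  let ?E = "\<lambda>n. {\<omega>\<in>space M. X 0 \<omega> = i \<and> X n \<omega> = j \<and> jump_count T t \<omega> = n}"
  have ev: "?E n \<in> events" for n by (intro sets.sets_Collect_conj event_X_eq event_jump_count_eq)
  have "prob (?E n) = prob {\<omega>\<in>space M. jump_count T t \<omega> = n}
      * (prob {\<omega>\<in>space M. X 0 \<omega> = i} * step_prob S Q n i j)" for n
    using jump_count_indep_chain prob_chain[OF S j] by simp
  moreover have "(\<lambda>n. prob (?E n)) sums prob (\<Union>n. ?E n)"
    using ev by (intro finite_measure_UNION) (auto simp: disjoint_family_on_def)
  moreover have "(\<Union>n. ?E n) = {\<omega>\<in>space M. semi_markov_process X T t \<omega> = j \<and> X 0 \<omega> = i}"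
    by (auto simp: semi_markov_process_def)
  ultimately have "(\<lambda>n. prob {\<omega>\<in>space M. jump_count T t \<omega> = n}
      * (prob {\<omega>\<in>space M. X 0 \<omega> = i} * step_prob S Q n i j))
      sums prob {\<omega>\<in>space M. semi_markov_process X T t \<omega> = j \<and> X 0 \<omega> = i}" by simp
  from sums_divide[OF this, of "prob {\<omega>\<in>space M. X 0 \<omega> = i}"]
  have "(\<lambda>n. prob {\<omega>\<in>space M. jump_count T t \<omega> = n} * step_prob S Q n i j) sums
    \<P>(\<omega> in M. semi_markov_process X T t \<omega> = j \<bar> X 0 \<omega> = i)"
    using i by (simp add: cond_prob_def mult.left_commute)
  also have "\<P>(\<omega> in M. semi_markov_process X T t \<omega> = j \<bar> X 0 \<omega> = i)
    = \<P>(\<omega> in M. semi_markov_process X T t \<omega> = j \<bar> semi_markov_process X T 0 \<omega> = i)"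
    using semi_markov_process_0
    by (intro cond_prob_eq_AE) (auto intro: event_semi_markov_process event_X_eq)
  finally show ?thesis .
qed

lemma jump_count_sums_1: "(\<lambda>n. prob {\<omega>\<in>space M. jump_count T t \<omega> = n}) sums 1"
proof -
  have "(\<Union>n. {\<omega>\<in>space M. jump_count T t \<omega> = n}) = space M" by auto
  moreover have "(\<lambda>n. prob {\<omega>\<in>space M. jump_count T t \<omega> = n})
      sums prob (\<Union>n. {\<omega>\<in>space M. jump_count T t \<omega> = n})"
    by (intro finite_measure_UNION) (auto simp: disjoint_family_on_def)
  ultimately show ?thesis by (simp add: prob_space)
qed

lemma tv_dist_semi_markov_le:
  assumes S: "finite S" and Q: "stochastic_matrix S Q" and inv: "invariant_distribution S Q \<pi>"
    and i: "i \<in> S" "0 < prob {\<omega>\<in>space M. X 0 \<omega> = i}"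
  shows "tv_dist S (\<lambda>j. \<P>(\<omega> in M. semi_markov_process X T t \<omega> = j \<bar> semi_markov_process X T 0 \<omega> = i)) \<pi>
    \<le> prob {\<omega>\<in>space M. jump_count T t \<omega> < m} + tv_dist S (step_prob S Q m i) \<pi>"
proof -
  have "prob {\<omega>\<in>space M. jump_count T t \<omega> < m}
      = prob (\<Union>n\<in>{..<m}. {\<omega>\<in>space M. jump_count T t \<omega> = n})"
    by (auto intro!: arg_cong[where f=prob])
  also have "\<dots> = (\<Sum>n<m. prob {\<omega>\<in>space M. jump_count T t \<omega> = n})"
    by (intro finite_measure_finite_Union) (auto simp: disjoint_family_on_def)
  finally have few: "prob {\<omega>\<in>space M. jump_count T t \<omega> < m} = \<dots>" .
  show ?thesis
    unfolding few
  proof (rule tv_dist_mixture[where q = "\<lambda>n. step_prob S Q n i" and m = m, OF _ jump_count_sums_1])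
    show "tv_dist S (step_prob S Q n i) \<pi> \<le> 1" for n
      using step_prob_nonneg[OF Q i(1)] step_prob_sum[OF S Q i(1)] inv
      by (intro tv_dist_le_1) (auto simp: invariant_distribution_def)
    show "0 \<le> tv_dist S (step_prob S Q m i) \<pi>" by (simp add: tv_dist_def sum_nonneg)
  qed (use transition_sums[OF S _ i(2)] tv_dist_step_prob_antimono[OF S Q inv i(1)] in auto)
qed

end

section \<open>Comparison of the mixing times\<close>

theorem theorem2p2:
  fixes S :: "'s set" and Q :: "'s \<Rightarrow> 's \<Rightarrow> real" and \<pi> :: "'s \<Rightarrow> real"
    and c1 c2 t0 \<beta> :: real
  assumes "finite S"
    and "stochastic_matrix S Q"
    and "irreducible_chain S Q"
    and "aperiodic_chain S Q"
    and "invariant_distribution S Q \<pi>"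
    and "c1 > 0" and "c2 > 0" and "t0 > 0" and "\<beta> > 0"
  shows "\<exists>C1>0. \<forall>(\<nu> :: real measure) (P :: 's \<Rightarrow> 'm measure)
             (X :: nat \<Rightarrow> 'm \<Rightarrow> 's) (T :: nat \<Rightarrow> 'm \<Rightarrow> real).
           semi_markov_family P S Q \<nu> X T \<longrightarrow>
           (\<forall>t>t0. c1 / t powr \<beta> \<le> measure \<nu> {t<..} \<and> measure \<nu> {t<..} \<le> c2 / t powr \<beta>) \<longrightarrow>
           (\<forall>\<epsilon>>0. T_cont S P X T \<pi> \<epsilon> <
              ereal (C1 * \<epsilon> powr (- 1 / \<beta>) * real (T_emb S Q \<pi> (\<epsilon> / 2)) powr (1 + 1 / \<beta>)))"
proof -
  have "S \<noteq> {}" using assms(5) by (auto simp: invariant_distribution_def)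
  define s where "s = real (card S)"
  have s: "s > 0" using \<open>S \<noteq> {}\<close> assms(1) by (simp add: s_def card_gt_0_iff)
  \<comment> \<open>The first summand ensures \<open>t / m > t0\<close> below, the second makes the few-jumps terms at most \<open>\<epsilon> / 2\<close>.\<close>
  define a where "a = t0 * s powr (1 / \<beta>) + (2 * s * c2) powr (1 / \<beta>)"
  have a_gt: "a > t0 * s powr (1 / \<beta>)" "a > (2 * s * c2) powr (1 / \<beta>)"
    using s assms(7-9) by (auto simp: a_def)
  have "a > 0" using s assms(7,8) by (simp add: a_def add_pos_pos)
  have a_powr: "2 * s * c2 \<le> a powr \<beta>"
    using powr_mono2[of \<beta> "(2 * s * c2) powr (1 / \<beta>)" a] a_gt(2) s assms(7,9) by (simp add: powr_powr)
  \<comment> \<open>The factor 2 makes the inequality strict.\<close>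
  have main: "T_cont S P X T \<pi> \<epsilon> <
      ereal (2 * a * \<epsilon> powr (- 1 / \<beta>) * real (T_emb S Q \<pi> (\<epsilon> / 2)) powr (1 + 1 / \<beta>))"
    if fam: "semi_markov_family P S Q \<nu> X T"
      and tail: "\<forall>t>t0. c1 / t powr \<beta> \<le> measure \<nu> {t<..} \<and> measure \<nu> {t<..} \<le> c2 / t powr \<beta>"
      and \<epsilon>: "\<epsilon> > 0"
    for \<nu> and P :: "'s \<Rightarrow> 'm measure" and X :: "nat \<Rightarrow> 'm \<Rightarrow> 's" and T \<epsilon>
  proof -
    define m where "m = T_emb S Q \<pi> (\<epsilon> / 2)"
    have m: "1 \<le> m" "(\<Sum>i\<in>S. tv_dist S (step_prob S Q m i) \<pi>) \<le> \<epsilon> / 2"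
      unfolding m_def using T_emb_attained[OF assms(1-5), of "\<epsilon> / 2"] \<epsilon> by auto
    define t where "t = a * \<epsilon> powr (- 1 / \<beta>) * real m powr (1 + 1 / \<beta>)"
    have "t > 0" using \<open>a > 0\<close> \<epsilon> m(1) by (simp add: t_def)
    have sm: "semi_markov (P i) S Q \<nu> X T" "0 < measure (P i) {\<omega>\<in>space (P i). X 0 \<omega> = i}"
      if "i \<in> S" for i
      using fam that by (auto simp: semi_markov_family_def)
    have row: "tv_dist S (trans_prob P X T u i) \<pi>
        \<le> measure (P i) {\<omega>\<in>space (P i). jump_count T u \<omega> < n} + tv_dist S (step_prob S Q n i) \<pi>"
      if "i \<in> S" for i u n
      using semi_markov.tv_dist_semi_markov_le[OF sm(1)[OF that] assms(1,2,5) that sm(2)[OF that], of u n]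
      by (simp add: trans_prob_def[abs_def])
    have "\<exists>u\<le>t. 0 \<le> u \<and> (\<Sum>i\<in>S. tv_dist S (trans_prob P X T u i) \<pi>) \<le> \<epsilon>"
    \<comment> \<open>A distance is at most 1, so for \<open>\<epsilon> \<ge> s\<close> time 0 will do; otherwise time \<open>t\<close> will.\<close>
    proof (cases "s \<le> \<epsilon>")
      case True
      have "tv_dist S (trans_prob P X T 0 i) \<pi> \<le> 1" if "i \<in> S" for i
      proof -
        have "tv_dist S (step_prob S Q 0 i) \<pi> \<le> 1"
          using step_prob_nonneg[OF assms(2) that] step_prob_sum[OF assms(1,2) that] assms(5)
          by (intro tv_dist_le_1) (auto simp: invariant_distribution_def simp del: step_prob.simps)
        then show ?thesis using row[OF that, of 0 0] by simp
      qed
      then have "(\<Sum>i\<in>S. tv_dist S (trans_prob P X T 0 i) \<pi>) \<le> s"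
        using sum_bounded_above[of S _ "1::real"] by (simp add: s_def)
      then show ?thesis using True \<open>t > 0\<close> by (intro exI[of _ 0]) auto
    next
      case False
      have t_div: "t / m = a * (m / \<epsilon>) powr (1 / \<beta>)"
        using m(1) \<epsilon> by (simp add: t_def powr_add powr_divide powr_minus_divide)
      have large: "t0 < t / m"
      proof -
        \<comment> \<open>Since \<open>\<epsilon> < s\<close> and \<open>m \<ge> 1\<close>, the ratio \<open>m / \<epsilon>\<close> is at least \<open>1 / s\<close>.\<close>
        have "t0 * s powr (1 / \<beta>) < a" by (rule a_gt)
        also have "a = a * (s powr (1 / \<beta>) * (1 / s) powr (1 / \<beta>))" 
          using s by (simp flip: powr_mult)
        also have "\<dots> \<le> a * (s powr (1 / \<beta>) * (m / \<epsilon>) powr (1 / \<beta>))"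
          using False m(1) \<epsilon> s \<open>a > 0\<close> assms(9)
          by (intro mult_left_mono powr_mono2 frac_le) auto
        also have "\<dots> = t / m * s powr (1 / \<beta>)" by (simp add: t_div)
        finally show ?thesis by (rule mult_right_less_imp_less) simp
      qed
      moreover have "t / m \<le> t" using m(1) \<open>t > 0\<close> by (simp add: divide_le_eq)
      ultimately have "c1 / t powr \<beta> \<le> measure \<nu> {t<..}" using tail by auto
      then have pos: "measure \<nu> {t<..} > 0"
        using assms(6) \<open>t > 0\<close> by (auto intro: less_le_trans[rotated])
      have "(t / m) powr \<beta> = a powr \<beta> * (m / \<epsilon>)"
        using t_div \<open>a > 0\<close> \<epsilon> assms(9) by (simp add: powr_mult powr_powr)
      then have "2 * s * c2 * (m / \<epsilon>) \<le> (t / m) powr \<beta>"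
        using mult_right_mono[OF a_powr, of "m / \<epsilon>"] \<epsilon> by simp
      then have "c2 / (t / m) powr \<beta> \<le> c2 / (2 * s * c2 * (m / \<epsilon>))"
        using m(1) \<epsilon> s assms(7) by (intro frac_le) auto
      then have "s * (m * (c2 / (t / m) powr \<beta>)) \<le> s * (m * (c2 / (2 * s * c2 * (m / \<epsilon>))))"
        using s by (intro mult_left_mono) auto
      also have "\<dots> = \<epsilon> / 2" using s m(1) assms(7) \<epsilon> by simp
      finally have few_total: "s * (m * (c2 / (t / m) powr \<beta>)) \<le> \<epsilon> / 2" .
      have few: "measure (P i) {\<omega>\<in>space (P i). jump_count T t \<omega> < m} \<le> m * (c2 / (t / m) powr \<beta>)"
        if "i \<in> S" for i
        using semi_markov.prob_few_jumps[OF sm(1)[OF that] m(1) pos] tail large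
        by (meson mult_left_mono of_nat_0_le_iff order_trans)
      have "(\<Sum>i\<in>S. tv_dist S (trans_prob P X T t i) \<pi>)
          \<le> (\<Sum>i\<in>S. m * (c2 / (t / m) powr \<beta>) + tv_dist S (step_prob S Q m i) \<pi>)"
        using row few by (intro sum_mono) (meson add_right_mono order_trans)
      also have "\<dots> = s * (m * (c2 / (t / m) powr \<beta>)) + (\<Sum>i\<in>S. tv_dist S (step_prob S Q m i) \<pi>)"
        by (simp add: sum.distrib s_def)
      also have "\<dots> \<le> \<epsilon>" using few_total m(2) by linarith
      finally show ?thesis using \<open>t > 0\<close> by (intro exI[of _ t]) auto
    qed
    then obtain u where u: "u \<le> t" "0 \<le> u" "(\<Sum>i\<in>S. tv_dist S (trans_prob P X T u i) \<pi>) \<le> \<epsilon>"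
      by blast
    then have "T_cont S P X T \<pi> \<epsilon> \<le> ereal u" unfolding T_cont_def by (intro Inf_lower) auto
    also have "\<dots> < ereal (2 * t)" using u(1) \<open>t > 0\<close> by simp
    finally show ?thesis by (simp add: t_def m_def mult.assoc)
  qed
  show ?thesis using main \<open>a > 0\<close> by (intro exI[of _ "2 * a"]) auto
qed

end
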